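(* The MSE due to $k$ erasures, $3\le k<N$, is minimized when the $m$-dimensional subspaces in the tight fusion frame $\{\mathcal{W}_i\}_{i=1}^N$ are maximal equi-distance subspaces.
   Context: A tight fusion frame for $\mathbb{R}^M$ is a finite collection of subspaces $\{\mathcal{W}_i\}_{i=1}^N$ of $\mathbb{R}^M$ whose orthogonal projections $\mathbf{P}_i$ satisfy $\sum_{i=1}^N\mathbf{P}_i=A\,\mathbf{I}$ for some $A>0$. The chordal distance between two $m$-dimensional subspaces $\mathcal{W}_i,\mathcal{W}_j$ with principal angles $\theta_1(i,j),\dots,\theta_m(i,j)$ is $d_c(i,j)=\big(\sum_{\ell=1}^m\sin^2\theta_\ell(i,j)\big)^{1/2}$; equivalently $d_c^2(i,j)=m-\mathrm{tr}[\mathbf{P}_i\mathbf{P}_j]$. A fusion frame of equi-dimensional subspaces with equal pairwise chordal distances that is tight is called an equi-distance tight fusion frame, and its subspaces are called maximal equi-distance subspaces (the name reflects that, for fusion frames consisting of equi-dimensional subspaces with equal pairwise chordal distances, the chordal distance is maximal if and only if the fusion frame is tight). Measurement model: $\mathbf{x}$ is a zero-mean random vector in $\mathbb{R}^M$ with covariance $\mathbf{R}_{xx}=E[\mathbf{x}\mathbf{x}^T]=\sigma_x^2\mathbf{I}$; the measurements are $\mathbf{z}_i=\mathbf{P}_i\mathbf{x}+\mathbf{n}_i$, $i=1,\dots,N$, where the noise vectors $\mathbf{n}_i$ are mutually uncorrelated, uncorrelated with $\mathbf{x}$, and $E[\mathbf{n}_i\mathbf{n}_i^T]=\sigma_n^2\mathbf{I}$.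 Put $\mathbf{z}=(\mathbf{z}_1^T,\dots,\mathbf{z}_N^T)^T\in\mathbb{R}^{NM}$. The no-erasure linear minimum mean-squared error (LMMSE) filter is $\mathbf{F}=\mathbf{R}_{xz}\mathbf{R}_{zz}^{-1}$, with $\mathbf{R}_{xz}=E[\mathbf{x}\mathbf{z}^T]$ and $\mathbf{R}_{zz}=E[\mathbf{z}\mathbf{z}^T]$. Erasures: for a set $\mathbb{S}\subset\{1,\dots,N\}$ of erased indices with $|\mathbb{S}|=k$, let $\mathbf{E}$ be the $NM\times NM$ block-diagonal matrix whose $i$th $M\times M$ diagonal block is $\mathbf{I}$ if $i\in\mathbb{S}$ and $\mathbf{0}$ otherwise. The signal is estimated by $\tilde{\mathbf{x}}=\mathbf{F}(\mathbf{I}-\mathbf{E})\mathbf{z}$ (the filter $\mathbf{F}$ is not recomputed), and the MSE due to the erasures is $\mathrm{tr}\,E[(\mathbf{x}-\tilde{\mathbf{x}})(\mathbf{x}-\tilde{\mathbf{x}})^T]$. Setting of the minimization: the fusion frame is assumed tight, and the subspaces are taken to have equal given dimension $m\ge\lceil M/N\rceil$ and equal pairwise chordal distance $d_c$, so as to fix the performance against one and two erasures. The MSE is then the no-erasure MSE, which is fixed by $m$, plus the extra MSE $\alpha^2(\sigma_x^2+\sigma_n^2)|\mathbb{S}|m+\alpha^2\sigma_x^2|\mathbb{S}|(|\mathbb{S}|-1)(m-d_c^2)$, where $\alpha=\sigma_x^2/(\sigma_x^2A+\sigma_n^2)$. The minimization is of this expression, and it is minimized when $d_c^2$ takes its maximum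 value. *)

theory Defs
  imports "HOL-Probability.Probability"
begin

definition orth_proj :: "(real ^ 'm) set \<Rightarrow> real ^ 'm \<Rightarrow> real ^ 'm" where
  "orth_proj W x = (THE y. y \<in> W \<and> (\<forall>w\<in>W. orthogonal (x - y) w))"

definition proj_mat :: "(real ^ 'm) set \<Rightarrow> real ^ 'm ^ 'm" where
  "proj_mat W = matrix (orth_proj W)"

text \<open>Families of subspaces are indexed by a finite type \<open>'i\<close>, so that \<open>N = CARD('i)\<close> and
  \<open>M = CARD('m)\<close>.\<close>

definition fusion_frame :: "('i::finite \<Rightarrow> (real ^ 'm) set) \<Rightarrow> bool" where
  "fusion_frame W \<longleftrightarrow> (\<forall>i. subspace (W i)) \<and>
     (\<exists>A B. 0 < A \<and> A \<le> B \<and>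
       (\<forall>x. A * (norm x)\<^sup>2 \<le> (\<Sum>i\<in>UNIV. (norm (orth_proj (W i) x))\<^sup>2) \<and>
            (\<Sum>i\<in>UNIV. (norm (orth_proj (W i) x))\<^sup>2) \<le> B * (norm x)\<^sup>2))"

definition tight_fusion_frame :: "('i::finite \<Rightarrow> (real ^ 'm) set) \<Rightarrow> real \<Rightarrow> bool" where
  "tight_fusion_frame W A \<longleftrightarrow> (\<forall>i. subspace (W i)) \<and> 0 < A \<and>
     (\<Sum>i\<in>UNIV. proj_mat (W i)) = A *\<^sub>R mat 1"

text \<open>The principal angles between two subspaces of the same dimension are defined by the usual
  recursion: the \<open>l\<close>-th pair of principal vectors maximizes the inner product over all pairs of
  unit vectors orthogonal to the preceding principal vectors. Indices start at 0. The vectors need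
  not be unique, but the angles with index below the dimension are.\<close>

definition principal_vectors ::
    "(real ^ 'm) set \<Rightarrow> (real ^ 'm) set \<Rightarrow> (nat \<Rightarrow> real ^ 'm) \<Rightarrow> (nat \<Rightarrow> real ^ 'm) \<Rightarrow> bool" where
  "principal_vectors U V u v \<longleftrightarrow>
     (let feasible = (\<lambda>l x y. x \<in> U \<and> y \<in> V \<and> norm x = 1 \<and> norm y = 1 \<and>
                          (\<forall>j<l. orthogonal x (u j) \<and> orthogonal y (v j)))
      in \<forall>l<dim U. feasible l (u l) (v l) \<and>
           (\<forall>x y. feasible l x y \<longrightarrow> x \<bullet> y \<le> u l \<bullet> v l))"

definition principal_angles ::
    "(real ^ 'm) set \<Rightarrow> (real ^ 'm) set \<Rightarrow> (nat \<Rightarrow> real) \<Rightarrow> bool" where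
  "principal_angles U V \<theta> \<longleftrightarrow>
     (\<exists>u v. principal_vectors U V u v \<and> (\<forall>l<dim U. \<theta> l = arccos (u l \<bullet> v l)))"

definition chordal_dist :: "(real ^ 'm) set \<Rightarrow> (real ^ 'm) set \<Rightarrow> real" where
  "chordal_dist U V =
     (let \<theta> = (SOME \<theta>. principal_angles U V \<theta>) in sqrt (\<Sum>l<dim U. (sin (\<theta> l))\<^sup>2))"

definition equi_distance_fusion_frame ::
    "nat \<Rightarrow> real \<Rightarrow> ('i::finite \<Rightarrow> (real ^ 'm) set) \<Rightarrow> bool" where
  "equi_distance_fusion_frame m d W \<longleftrightarrow> fusion_frame W \<and> (\<forall>i. dim (W i) = m) \<and>
     (\<forall>i j. i \<noteq> j \<longrightarrow> chordal_dist (W i) (W j) = d)"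

text \<open>The members of such a family are the maximal equi-distance subspaces.\<close>

definition equi_distance_tight_fusion_frame ::
    "nat \<Rightarrow> real \<Rightarrow> real \<Rightarrow> ('i::finite \<Rightarrow> (real ^ 'm) set) \<Rightarrow> bool" where
  "equi_distance_tight_fusion_frame m d A W \<longleftrightarrow>
     equi_distance_fusion_frame m d W \<and> tight_fusion_frame W A"

text \<open>The matrix \<open>E[X Y\<^sup>T]\<close>.\<close>

definition cross_moment ::
    "'w measure \<Rightarrow> ('w \<Rightarrow> real ^ 'a) \<Rightarrow> ('w \<Rightarrow> real ^ 'b) \<Rightarrow> real ^ 'b ^ 'a" where
  "cross_moment P X Y = (\<chi> a b. integral\<^sup>L P (\<lambda>\<omega>. X \<omega> $ a * Y \<omega> $ b))"

text \<open>Being uncorrelated is expressed by \<open>E[X Y\<^sup>T] = 0\<close>. For \<open>x\<close> and \<open>n i\<close> this is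
  vanishing covariance because \<open>x\<close> has mean zero; for two noise vectors it is vanishing covariance
  as soon as the noise has mean zero, which is not needed otherwise.\<close>

definition measurement_model ::
    "'w measure \<Rightarrow> real \<Rightarrow> real \<Rightarrow> ('w \<Rightarrow> real ^ 'm) \<Rightarrow> ('i \<Rightarrow> 'w \<Rightarrow> real ^ 'm) \<Rightarrow> bool" where
  "measurement_model P \<sigma>x \<sigma>n x n \<longleftrightarrow>
     prob_space P \<and>
     x \<in> borel_measurable P \<and> integrable P (\<lambda>\<omega>. (norm (x \<omega>))\<^sup>2) \<and>
     (\<forall>i. n i \<in> borel_measurable P \<and> integrable P (\<lambda>\<omega>. (norm (n i \<omega>))\<^sup>2)) \<and>
     integral\<^sup>L P x = 0 \<and>
     cross_moment P x x = \<sigma>x\<^sup>2 *\<^sub>R mat 1 \<and>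
     (\<forall>i. cross_moment P (n i) (n i) = \<sigma>n\<^sup>2 *\<^sub>R mat 1) \<and>
     (\<forall>i j. i \<noteq> j \<longrightarrow> cross_moment P (n i) (n j) = 0) \<and>
     (\<forall>i. cross_moment P x (n i) = 0)"

text \<open>Vectors of \<open>NM\<close> components are indexed by pairs (block, position inside the block).\<close>

definition measurement ::
    "('i::finite \<Rightarrow> (real ^ 'm) set) \<Rightarrow> ('w \<Rightarrow> real ^ 'm) \<Rightarrow> ('i \<Rightarrow> 'w \<Rightarrow> real ^ 'm) \<Rightarrow>
      'w \<Rightarrow> real ^ ('i \<times> 'm)" where
  "measurement W x n \<omega> =
     (\<chi> p. (proj_mat (W (fst p)) *v x \<omega> + n (fst p) \<omega>) $ snd p)"

definition lmmse_filter ::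
    "'w measure \<Rightarrow> ('w \<Rightarrow> real ^ 'm) \<Rightarrow> ('w \<Rightarrow> real ^ 'p) \<Rightarrow> real ^ 'p ^ 'm" where
  "lmmse_filter P x z = cross_moment P x z ** matrix_inv (cross_moment P z z)"

definition erasure_mat :: "'i set \<Rightarrow> real ^ ('i::finite \<times> 'm::finite) ^ ('i \<times> 'm)" where
  "erasure_mat S = (\<chi> p q. if p = q \<and> fst p \<in> S then 1 else 0)"

definition erasure_estimate ::
    "'w measure \<Rightarrow> ('w \<Rightarrow> real ^ 'm) \<Rightarrow> ('i \<Rightarrow> 'w \<Rightarrow> real ^ 'm) \<Rightarrow>
      ('i::finite \<Rightarrow> (real ^ 'm) set) \<Rightarrow> 'i set \<Rightarrow> 'w \<Rightarrow> real ^ 'm" where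
  "erasure_estimate P x n W S \<omega> =
     (lmmse_filter P x (measurement W x n) ** (mat 1 - erasure_mat S)) *v measurement W x n \<omega>"

definition erasure_mse ::
    "'w measure \<Rightarrow> ('w \<Rightarrow> real ^ 'm) \<Rightarrow> ('i \<Rightarrow> 'w \<Rightarrow> real ^ 'm) \<Rightarrow>
      ('i::finite \<Rightarrow> (real ^ 'm) set) \<Rightarrow> 'i set \<Rightarrow> real" where
  "erasure_mse P x n W S =
     (let e = (\<lambda>\<omega>. x \<omega> - erasure_estimate P x n W S \<omega>) in trace (cross_moment P e e))"

text \<open>The extra MSE caused by \<open>k\<close> erasures, as a function of the common chordal distance \<open>d\<close>;
  the frame bound \<open>A\<close> is that of a tight fusion frame of \<open>m\<close>-dimensional subspaces.\<close>

definition extra_mse :: "real \<Rightarrow> real \<Rightarrow> real \<Rightarrow> nat \<Rightarrow> nat \<Rightarrow> real \<Rightarrow> real" where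
  "extra_mse \<sigma>x \<sigma>n A m k d =
     (let \<alpha> = \<sigma>x\<^sup>2 / (\<sigma>x\<^sup>2 * A + \<sigma>n\<^sup>2) in
       \<alpha>\<^sup>2 * (\<sigma>x\<^sup>2 + \<sigma>n\<^sup>2) * real k * real m +
       \<alpha>\<^sup>2 * \<sigma>x\<^sup>2 * real k * (real k - 1) * (real m - d\<^sup>2))"

end

theory Submission
  imports Defs
begin

text \<open>Two independent computations meet in the theorem.

The first expresses chordal distances through projections: \<open>d\<^sub>c\<^sup>2 = m - tr (P\<^sub>i P\<^sub>j)\<close>
(\<open>chordal_dist_squared\<close>). Principal vectors \<open>u\<^sub>l\<close>, \<open>v\<^sub>l\<close> are orthonormal bases of
the two subspaces. The maximality in their definition forces \<open>u\<^sub>l \<bullet> v\<^sub>j = 0\<close> for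
\<open>l \<noteq> j\<close>: otherwise turning \<open>v\<^sub>l\<close> (or \<open>u\<^sub>l\<close>) towards the other vector would enlarge
the inner product. Hence \<open>tr (P\<^sub>i P\<^sub>j)\<close>, which is the sum of all
\<open>(u\<^sub>l \<bullet> v\<^sub>j)\<^sup>2\<close>, reduces to the sum of the squared cosines. Consequently, with
\<open>C\<close> the sum of \<open>k\<close> of the projections,
\<open>tr (C\<^sup>2) = k m + k (k - 1) (m - d\<^sub>c\<^sup>2)\<close> (\<open>frame_potential\<close>).

The second is the error covariance. Stack the measurements as \<open>z = T x + \<nu>\<close>, where \<open>\<nu>\<close>
is white noise and \<open>T\<^sup>T T\<close> is the sum of the projections. For a tight frame
\<open>T\<^sup>T T = A I\<close>, so that
\<open>T\<^sup>T (\<sigma>x\<^sup>2 T T\<^sup>T + \<sigma>n\<^sup>2 I) = (\<sigma>x\<^sup>2 A + \<sigma>n\<^sup>2) T\<^sup>T\<close> and the LMMSE filter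
collapses to \<open>\<alpha> T\<^sup>T\<close> (\<open>lmmse_filter_tight\<close>). The error after erasures is then
\<open>((1 - \<alpha> A) I + \<alpha> C) x\<close> minus filtered noise, where \<open>C\<close> is the sum of the erased
projections. Its mean square is a constant plus
\<open>\<alpha>\<^sup>2 \<sigma>n\<^sup>2 tr C + \<alpha>\<^sup>2 \<sigma>x\<^sup>2 tr (C\<^sup>2)\<close> (\<open>erasure_mse_tight\<close>), which by the
first computation is the no-erasure MSE plus \<open>extra_mse\<close>. The frame bound \<open>A = N m / M\<close> is
the same for all tight frames with these parameters, as taking traces shows.

It remains to see that a tight frame has the largest possible distance, because \<open>extra_mse\<close>
never increases with \<open>d\<^sub>c\<^sup>2\<close>. For the sum \<open>Q\<close> of all projections of any family of
\<open>m\<close>-dimensional subspaces, the Cauchy-Schwarz inequality gives \<open>(tr Q)\<^sup>2 \<le> M tr (Q\<^sup>2)\<close>, with equality when \<open>Q = A I\<close>.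
Here \<open>tr Q = N m\<close> is fixed and \<open>tr (Q\<^sup>2)\<close> is decreasing in \<open>d\<^sub>c\<^sup>2\<close>, so this bounds the distance
by that of a tight frame (\<open>chordal_dist_le_tight\<close>).\<close>

section \<open>Orthogonal projections in orthonormal coordinates\<close>

definition orthonormal_family :: "nat \<Rightarrow> (nat \<Rightarrow> 'a::real_inner) \<Rightarrow> bool" where
  "orthonormal_family r u \<longleftrightarrow> (\<forall>l<r. \<forall>j<r. u l \<bullet> u j = (if l = j then 1 else 0))"

lemma orthonormal_family_spans:
  fixes W :: "'a::euclidean_space set"
  assumes W: "subspace W" and u: "orthonormal_family (dim W) u" and mem: "\<And>l. l < dim W \<Longrightarrow> u l \<in> W"
  shows "span (u ` {..<dim W}) = W"
proof -
  let ?B = "u ` {..<dim W}"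
  have inj: "inj_on u {..<dim W}"
    using u unfolding orthonormal_family_def inj_on_def by (metis lessThan_iff zero_neq_one)
  have "pairwise orthogonal ?B"
    using u by (auto simp: pairwise_def orthogonal_def orthonormal_family_def)
  moreover have "0 \<notin> ?B"
    using u by (auto simp: orthonormal_family_def) (metis inner_zero_left zero_neq_one)
  ultimately have ind: "independent ?B"
    by (rule pairwise_orthogonal_independent)
  have sub: "?B \<subseteq> W" using mem by auto
  have "W \<subseteq> span ?B"
    by (rule card_ge_dim_independent[OF sub ind]) (simp add: card_image[OF inj])
  then show ?thesis
    using sub W by (metis span_minimal subset_antisym)
qed

lemma orthonormal_family_exists:
  fixes W :: "'a::euclidean_space set"
  assumes "subspace W"
  obtains u where "orthonormal_family (dim W) u" "\<And>l. l < dim W \<Longrightarrow> u l \<in> W"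
proof -
  obtain B where B: "B \<subseteq> W" "pairwise orthogonal B" "\<And>x. x \<in> B \<Longrightarrow> norm x = 1"
    "independent B" "card B = dim W"
    using orthonormal_basis_subspace[OF assms] by metis
  have "finite B" using B(4) by (rule independent_imp_finite)
  then obtain u where u: "bij_betw u {..<dim W} B"
    using ex_bij_betw_nat_finite B(5) by (metis atLeast0LessThan)
  have mem: "u l \<in> B" if "l < dim W" for l
    using u that by (auto simp: bij_betw_def)
  have "u l \<bullet> u j = (if l = j then 1 else 0)" if "l < dim W" "j < dim W" for l j
  proof (cases "l = j")
    case True
    then show ?thesis using B(3)[OF mem[OF that(1)]] by (simp add: norm_eq_1)
  next
    case False
    then have "u l \<noteq> u j"
      using u that by (auto simp: bij_betw_def inj_on_def)
    then show ?thesis using False B(2) mem that by (auto simp: pairwise_def orthogonal_def)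
  qed
  then show thesis
    using that[of u] mem B(1) by (auto simp: orthonormal_family_def)
qed

lemma orth_proj_eq:
  assumes W: "subspace W" and y: "y \<in> W" and o: "\<And>w. w \<in> W \<Longrightarrow> orthogonal (x - y) w"
  shows "orth_proj W x = y"
  unfolding orth_proj_def
proof (rule the_equality)
  fix z assume z: "z \<in> W \<and> (\<forall>w\<in>W. orthogonal (x - z) w)"
  have "y - z \<in> W" using W y z by (simp add: subspace_diff)
  then have "(x - z) \<bullet> (y - z) = 0" "(x - y) \<bullet> (y - z) = 0"
    using z o by (auto simp: orthogonal_def)
  then have "(y - z) \<bullet> (y - z) = 0" by (simp add: algebra_simps inner_commute)
  then show "z = y" by simp
qed (use assms in auto)

lemma orth_proj_orthonormal:
  fixes W :: "(real ^ 'm) set"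
  assumes W: "subspace W" and u: "orthonormal_family (dim W) u" and mem: "\<And>l. l < dim W \<Longrightarrow> u l \<in> W"
  shows "orth_proj W x = (\<Sum>l<dim W. (u l \<bullet> x) *\<^sub>R u l)"
proof (rule orth_proj_eq[OF W])
  let ?y = "\<Sum>l<dim W. (u l \<bullet> x) *\<^sub>R u l"
  show "?y \<in> W"
    using mem by (intro subspace_sum[OF W] subspace_scale[OF W]) auto
  have "(x - ?y) \<bullet> u j = 0" if "j < dim W" for j
  proof -
    have "?y \<bullet> u j = (\<Sum>l<dim W. (u l \<bullet> x) * (u l \<bullet> u j))"
      by (simp add: inner_sum_left)
    also have "\<dots> = (\<Sum>l<dim W. if l = j then u j \<bullet> x else 0)"
      using u that by (intro sum.cong) (auto simp: orthonormal_family_def)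
    also have "\<dots> = x \<bullet> u j" using that by (simp add: inner_commute)
    finally show ?thesis by (simp add: inner_diff_left)
  qed
  then have "orthogonal (x - ?y) w" if "w \<in> span (u ` {..<dim W})" for w
    using orthogonal_to_span[OF that] by (auto simp: orthogonal_def)
  then show "orthogonal (x - ?y) w" if "w \<in> W" for w
    using orthonormal_family_spans[OF assms] that by auto
qed

lemma proj_mat_orthonormal:
  fixes W :: "(real ^ 'm) set"
  assumes "subspace W" "orthonormal_family (dim W) u" "\<And>l. l < dim W \<Longrightarrow> u l \<in> W"
  shows "proj_mat W $ a $ b = (\<Sum>l<dim W. u l $ a * u l $ b)"
  using orth_proj_orthonormal[OF assms]
  by (simp add: proj_mat_def matrix_def inner_axis mult.commute)

lemma sum_swap3:
  "(\<Sum>a\<in>A. \<Sum>l\<in>L. \<Sum>j\<in>J. f a l j) = (\<Sum>l\<in>L. \<Sum>j\<in>J. \<Sum>a\<in>A. f a l j)"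
  by (rule trans[OF sum.swap]) (rule sum.cong[OF refl], rule sum.swap)

text \<open>By \<open>proj_mat_orthonormal\<close>, \<open>P\<^sub>U\<close> is the sum of the \<open>u\<^sub>l u\<^sub>l\<^sup>T\<close> and \<open>P\<^sub>V\<close> that of the
\<open>v\<^sub>j v\<^sub>j\<^sup>T\<close>, and the trace of \<open>u u\<^sup>T v v\<^sup>T\<close> is \<open>(u \<bullet> v)\<^sup>2\<close>.\<close>

lemma trace_proj_mat_mult:
  fixes U V :: "(real ^ 'm) set"
  assumes "subspace U" "orthonormal_family (dim U) u" "\<And>l. l < dim U \<Longrightarrow> u l \<in> U"
    and "subspace V" "orthonormal_family (dim V) v" "\<And>l. l < dim V \<Longrightarrow> v l \<in> V"
  shows "trace (proj_mat U ** proj_mat V) = (\<Sum>l<dim U. \<Sum>j<dim V. (u l \<bullet> v j)\<^sup>2)"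
proof -
  have "trace (proj_mat U ** proj_mat V) =
      (\<Sum>a\<in>UNIV. \<Sum>b\<in>UNIV. \<Sum>l<dim U. \<Sum>j<dim V. (u l $ a * v j $ a) * (u l $ b * v j $ b))"
    by (simp add: trace_def matrix_matrix_mult_def proj_mat_orthonormal[OF assms(1-3)]
        proj_mat_orthonormal[OF assms(4-6)] sum_product mult_ac)
  also have "\<dots> = (\<Sum>l<dim U. \<Sum>j<dim V. \<Sum>a\<in>UNIV. \<Sum>b\<in>UNIV. (u l $ a * v j $ a) * (u l $ b * v j $ b))"
    by (rule trans[OF sum.cong[OF refl sum_swap3] sum_swap3])
  also have "\<dots> = (\<Sum>l<dim U. \<Sum>j<dim V. (u l \<bullet> v j)\<^sup>2)"
    by (simp add: inner_vec_def power2_eq_square sum_product)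
  finally show ?thesis .
qed

lemma transpose_proj_mat:
  assumes "subspace W"
  shows "transpose (proj_mat W) = proj_mat W"
proof -
  obtain u where u: "orthonormal_family (dim W) u" "\<And>l. l < dim W \<Longrightarrow> u l \<in> W"
    using orthonormal_family_exists[OF assms] by blast
  show ?thesis
    by (simp add: vec_eq_iff transpose_def proj_mat_orthonormal[OF assms u] mult.commute)
qed

lemma proj_mat_idem:
  assumes "subspace W"
  shows "proj_mat W ** proj_mat W = proj_mat W"
proof -
  obtain u where u: "orthonormal_family (dim W) u" "\<And>l. l < dim W \<Longrightarrow> u l \<in> W"
    using orthonormal_family_exists[OF assms] by blast
  have "(proj_mat W ** proj_mat W) $ a $ b = proj_mat W $ a $ b" for a b
  proof -
    have "(proj_mat W ** proj_mat W) $ a $ b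
        = (\<Sum>c\<in>UNIV. \<Sum>l<dim W. \<Sum>j<dim W. u l $ a * u j $ b * (u l $ c * u j $ c))"
      by (simp add: matrix_matrix_mult_def proj_mat_orthonormal[OF assms u] sum_product mult_ac)
    also have "\<dots> = (\<Sum>l<dim W. \<Sum>j<dim W. u l $ a * u j $ b * (u l \<bullet> u j))"
      by (rule trans[OF sum_swap3]) (simp add: inner_vec_def sum_distrib_left)
    also have "\<dots> = (\<Sum>l<dim W. \<Sum>j<dim W. if l = j then u l $ a * u j $ b else 0)"
      using u(1) by (intro sum.cong) (auto simp: orthonormal_family_def)
    also have "\<dots> = (\<Sum>l<dim W. u l $ a * u l $ b)"
      by (intro sum.cong) auto
    finally show ?thesis by (simp add: proj_mat_orthonormal[OF assms u])
  qed
  then show ?thesis by (simp add: vec_eq_iff)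
qed

lemma trace_proj_mat:
  assumes "subspace W"
  shows "trace (proj_mat W) = dim W"
proof -
  obtain u where u: "orthonormal_family (dim W) u" "\<And>l. l < dim W \<Longrightarrow> u l \<in> W"
    using orthonormal_family_exists[OF assms] by blast
  have "trace (proj_mat W) = trace (proj_mat W ** proj_mat W)"
    by (simp add: proj_mat_idem[OF assms])
  also have "\<dots> = (\<Sum>l<dim W. \<Sum>j<dim W. if l = j then 1 else 0)"
    using trace_proj_mat_mult[OF assms u assms u] u(1)
    by (simp add: orthonormal_family_def if_distrib[of "\<lambda>t. t\<^sup>2"] cong: if_cong)
  also have "\<dots> = dim W" by simp
  finally show ?thesis .
qed

section \<open>Principal vectors and the chordal distance\<close>

text \<open>The first-order condition behind the diagonal form of principal vectors. On the span of \<open>y\<close>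
and \<open>z\<close> the functional \<open>x \<bullet> _\<close> is represented by \<open>a y + b z\<close> with \<open>a = x \<bullet> y\<close>,
\<open>b = x \<bullet> z\<close>, so it reaches \<open>sqrt (a\<^sup>2 + b\<^sup>2)\<close> on unit vectors, which exceeds \<open>a\<close>
unless \<open>b = 0\<close>.\<close>

lemma max_inner_imp_orthogonal:
  fixes x :: "'a::real_inner"
  assumes y: "norm y = 1" and z: "norm z = 1" and yz: "orthogonal y z"
    and max: "\<And>s t. norm (s *\<^sub>R y + t *\<^sub>R z) = 1 \<Longrightarrow> x \<bullet> (s *\<^sub>R y + t *\<^sub>R z) \<le> x \<bullet> y"
  shows "orthogonal x z"
proof (rule ccontr)
  define a b r where "a = x \<bullet> y" and "b = x \<bullet> z" and "r = sqrt (a\<^sup>2 + b\<^sup>2)"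
  assume "\<not> orthogonal x z"
  then have b: "b \<noteq> 0" by (simp add: b_def orthogonal_def)
  then have r: "r > 0" "r\<^sup>2 = a\<^sup>2 + b\<^sup>2"
    by (simp_all add: r_def sum_power2_gt_zero_iff)
  let ?w = "(a / r) *\<^sub>R y + (b / r) *\<^sub>R z"
  have yy: "y \<bullet> y = 1" "z \<bullet> z = 1" "y \<bullet> z = 0" "z \<bullet> y = 0"
    using y z yz by (auto simp: norm_eq_1 orthogonal_def inner_commute)
  have "?w \<bullet> ?w = (a\<^sup>2 + b\<^sup>2) / r\<^sup>2"
    by (simp add: inner_add_left inner_add_right yy power2_eq_square add_divide_distrib)
  then have "norm ?w = 1" using r(1) by (simp add: norm_eq_1 flip: r(2))
  then have "x \<bullet> ?w \<le> a" unfolding a_def by (rule max)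
  moreover have "x \<bullet> ?w = (a\<^sup>2 + b\<^sup>2) / r"
    by (simp add: inner_add_right a_def b_def power2_eq_square add_divide_distrib)
  then have "x \<bullet> ?w = r" using r(1) unfolding r(2)[symmetric] by (simp add: power2_eq_square)
  ultimately have "r \<le> a" by simp
  then have "r\<^sup>2 \<le> a\<^sup>2" using r(1) by (intro power_mono) auto
  with r(2) b show False by simp
qed

text \<open>The feasible predicate of \<open>principal_vectors\<close>, as a set of pairs so that compactness can be
applied to it.\<close>

definition principal_feasible ::
    "(real ^ 'm) set \<Rightarrow> (real ^ 'm) set \<Rightarrow> (nat \<Rightarrow> real ^ 'm) \<Rightarrow> (nat \<Rightarrow> real ^ 'm) \<Rightarrow> nat \<Rightarrow>
      ((real ^ 'm) \<times> (real ^ 'm)) set" where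
  "principal_feasible U V u v l = {(x, y). x \<in> U \<and> y \<in> V \<and> norm x = 1 \<and> norm y = 1 \<and>
      (\<forall>j<l. orthogonal x (u j) \<and> orthogonal y (v j))}"

lemma principal_vectors_iff:
  "principal_vectors U V u v \<longleftrightarrow> (\<forall>l<dim U. (u l, v l) \<in> principal_feasible U V u v l \<and>
     (\<forall>x y. (x, y) \<in> principal_feasible U V u v l \<longrightarrow> x \<bullet> y \<le> u l \<bullet> v l))"
  unfolding principal_vectors_def principal_feasible_def Let_def by simp

lemma unit_vector_orthogonal_exists:
  fixes U :: "'a::euclidean_space set"
  assumes "subspace U" "l < dim U"  "\<And>j. j < l \<Longrightarrow> u j \<in> U"
  obtains x where "x \<in> U" "norm x = 1" "\<And>j. j < l \<Longrightarrow> orthogonal x (u j)"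
proof -
  let ?B = "u ` {..<l}"
  have "dim ?B \<le> card ?B" by (rule dim_le_card') simp
  also have "\<dots> \<le> l" using card_image_le[of "{..<l}" u] by simp
  finally have "dim ?B < dim U" using assms(2) by simp
  moreover have "span ?B \<subseteq> U"
    using assms by (intro span_minimal) auto
  ultimately have "span ?B \<subset> span U"
    using assms(1) by (metis dim_span order_less_irrefl psubsetI span_eq_iff)
  then obtain x where x: "x \<noteq> 0" "x \<in> span U" "\<And>y. y \<in> span ?B \<Longrightarrow> orthogonal x y"
    using orthogonal_to_subspace_exists_gen by blast
  show thesis
  proof
    show "x /\<^sub>R norm x \<in> U" using x assms(1) by (metis span_eq_iff subspace_scale)
    show "norm (x /\<^sub>R norm x) = 1" using x by simp
    show "orthogonal (x /\<^sub>R norm x) (u j)" if "j < l" for j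
      using x(3)[of "u j"] that by (simp add: orthogonal_clauses span_base)
  qed
qed

lemma principal_feasible_compact:
  fixes U V :: "(real ^ 'm) set"
  assumes "subspace U" "subspace V"
  shows "compact (principal_feasible U V u v l)"
proof -
  have eq: "principal_feasible U V u v l =
      ((U \<inter> sphere 0 1) \<times> (V \<inter> sphere 0 1)) \<inter> (\<Inter>j\<in>{..<l}. {p. fst p \<bullet> u j = 0} \<inter> {p. snd p \<bullet> v j = 0})"
    by (auto simp: principal_feasible_def orthogonal_def)
  have "compact ((U \<inter> sphere 0 1) \<times> (V \<inter> sphere 0 1))"
    using assms by (intro compact_Times closed_Int_compact closed_subspace) auto
  moreover have "closed (\<Inter>j\<in>{..<l}. {p :: (real^'m) \<times> (real^'m). fst p \<bullet> u j = 0} \<inter> {p. snd p \<bullet> v j = 0})"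
    by (intro closed_INT ballI closed_Int closed_Collect_eq continuous_intros)
  ultimately show ?thesis unfolding eq by (rule compact_Int_closed)
qed

text \<open>Feasibility at level \<open>l\<close> sees only the pairs below \<open>l\<close>; this is what allows principal vectors
to be chosen one after the other.\<close>

lemma principal_feasible_cong:
  assumes "\<And>j. j < l \<Longrightarrow> u j = u' j" "\<And>j. j < l \<Longrightarrow> v j = v' j"
  shows "principal_feasible U V u v l = principal_feasible U V u' v' l"
  using assms by (auto simp: principal_feasible_def)

text \<open>Without existence, the choice operator in \<open>chordal_dist\<close> would select an arbitrary sequence of
angles. At each level the feasible set is compact, and it is nonempty because fewer than
\<open>dim U = dim V\<close> vectors have been chosen on either side.\<close>

lemma principal_vectors_exist:
  fixes U V :: "(real ^ 'm) set"
  assumes U: "subspace U" and V: "subspace V" and dim: "dim V = dim U"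
  obtains u v where "principal_vectors U V u v"
proof -
  let ?good = "\<lambda>u v l. (u l, v l) \<in> principal_feasible U V u v l \<and>
     (\<forall>x y. (x, y) \<in> principal_feasible U V u v l \<longrightarrow> x \<bullet> y \<le> u l \<bullet> v l)"
  have "\<exists>u v. \<forall>l<r. ?good u v l" if "r \<le> dim U" for r
    using that
  proof (induction r)
    case 0
    show ?case by simp
  next
    case (Suc r)
    then obtain u v where uv: "\<forall>l<r. ?good u v l" by auto
    have mem: "u j \<in> U" "v j \<in> V" if "j < r" for j
      using uv that by (auto simp: principal_feasible_def)
    have r: "r < dim U" "r < dim V" using Suc dim by auto
    obtain x where x: "x \<in> U" "norm x = 1" "\<And>j. j < r \<Longrightarrow> orthogonal x (u j)"
      using unit_vector_orthogonal_exists[OF U r(1), of u] mem(1) by metis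
    obtain y where y: "y \<in> V" "norm y = 1" "\<And>j. j < r \<Longrightarrow> orthogonal y (v j)"
      using unit_vector_orthogonal_exists[OF V r(2), of v] mem(2) by metis
    have "(x, y) \<in> principal_feasible U V u v r"
      using x y by (simp add: principal_feasible_def)
    then have "principal_feasible U V u v r \<noteq> {}" by auto
    moreover have "continuous_on (principal_feasible U V u v r) (\<lambda>p. fst p \<bullet> snd p)"
      by (intro continuous_intros)
    ultimately have "\<exists>p\<in>principal_feasible U V u v r. \<forall>q\<in>principal_feasible U V u v r.
        fst q \<bullet> snd q \<le> fst p \<bullet> snd p"
      by (rule continuous_attains_sup[OF principal_feasible_compact[OF U V]])
    then obtain p where p: "p \<in> principal_feasible U V u v r"
      "\<And>q. q \<in> principal_feasible U V u v r \<Longrightarrow> fst q \<bullet> snd q \<le> fst p \<bullet> snd p"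
      by blast
    let ?u = "u(r := fst p)" and ?v = "v(r := snd p)"
    have same: "principal_feasible U V ?u ?v l = principal_feasible U V u v l" if "l \<le> r" for l
      using that by (intro principal_feasible_cong) auto
    have "?good ?u ?v l" if l: "l < Suc r" for l
    proof (cases "l = r")
      case True
      then show ?thesis using p(1) p(2) by (auto simp: same)
    next
      case False
      then have "l < r" using l by simp
      then show ?thesis using uv by (auto simp: same)
    qed
    then show ?case by blast
  qed
  from this[OF order_refl] show thesis
    using that by (auto simp: principal_vectors_iff)
qed

lemma principal_vectors_orthonormal:
  assumes pv: "principal_vectors U V u v" and dim: "dim V = dim U"
  shows "orthonormal_family (dim U) u" "orthonormal_family (dim V) v"
    "\<And>l. l < dim U \<Longrightarrow> u l \<in> U" "\<And>l. l < dim V \<Longrightarrow> v l \<in> V"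
proof -
  have f: "(u l, v l) \<in> principal_feasible U V u v l" if "l < dim U" for l
    using pv that by (auto simp: principal_vectors_iff)
  have "u l \<bullet> u j = (if l = j then 1 else 0) \<and> v l \<bullet> v j = (if l = j then 1 else 0)"
    if "l < dim U" "j < dim U" for l j
    using f[OF that(1)] f[OF that(2)]
    by (cases l j rule: linorder_cases)
      (auto simp: principal_feasible_def orthogonal_def norm_eq_1 inner_commute)
  then show "orthonormal_family (dim U) u" "orthonormal_family (dim V) v"
    by (auto simp: orthonormal_family_def dim)
  show "u l \<in> U" if "l < dim U" for l using f[OF that] by (auto simp: principal_feasible_def)
  show "v l \<in> V" if "l < dim V" for l using f[of l] that dim by (auto simp: principal_feasible_def)
qed

text \<open>For \<open>l < j\<close> the vectors \<open>u j\<close> and \<open>v j\<close> are orthogonal to everything chosen up to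
level \<open>l\<close>, so every unit combination of \<open>v l\<close> and \<open>v j\<close> (or of \<open>u l\<close> and \<open>u j\<close>)
still competes with the pair at level \<open>l\<close>, and \<open>max_inner_imp_orthogonal\<close> applies.\<close>

lemma principal_vectors_cross_orthogonal:
  fixes U V :: "(real ^ 'm) set"
  assumes U: "subspace U" and V: "subspace V" and dim: "dim V = dim U"
    and pv: "principal_vectors U V u v" and l: "l < dim U" and j: "j < dim U" and "l \<noteq> j"
  shows "u l \<bullet> v j = 0"
proof -
  have f: "(u l, v l) \<in> principal_feasible U V u v l" if "l < dim U" for l
    using pv that by (auto simp: principal_vectors_iff)
  have opt: "x \<bullet> y \<le> u l \<bullet> v l" if "(x, y) \<in> principal_feasible U V u v l" "l < dim U" for x y l
    using pv that by (auto simp: principal_vectors_iff)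
  have *: "orthogonal (u l) (v j) \<and> orthogonal (v l) (u j)"
    if lj: "l < j" and j: "j < dim U" for l j
  proof
    have l: "l < dim U" using that by simp
    note fl = f[OF l, unfolded principal_feasible_def] and fj = f[OF j, unfolded principal_feasible_def]
    have o: "orthogonal (v l) (v j)" "orthogonal (u l) (u j)"
      using fj lj by (auto simp: orthogonal_commute)
    show "orthogonal (u l) (v j)"
    proof (rule max_inner_imp_orthogonal[of "v l"])
      fix s t assume n: "norm (s *\<^sub>R v l + t *\<^sub>R v j) = 1"
      have "(u l, s *\<^sub>R v l + t *\<^sub>R v j) \<in> principal_feasible U V u v l"
        using fl fj lj n V
        by (auto simp: principal_feasible_def orthogonal_clauses subspace_add subspace_scale)
      then show "u l \<bullet> (s *\<^sub>R v l + t *\<^sub>R v j) \<le> u l \<bullet> v l" using l by (rule opt)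
    qed (use fl fj o in auto)
    show "orthogonal (v l) (u j)"
    proof (rule max_inner_imp_orthogonal[of "u l"])
      fix s t assume n: "norm (s *\<^sub>R u l + t *\<^sub>R u j) = 1"
      have "(s *\<^sub>R u l + t *\<^sub>R u j, v l) \<in> principal_feasible U V u v l"
        using fl fj lj n U
        by (auto simp: principal_feasible_def orthogonal_clauses subspace_add subspace_scale)
      then have "(s *\<^sub>R u l + t *\<^sub>R u j) \<bullet> v l \<le> u l \<bullet> v l" using l by (rule opt)
      then show "v l \<bullet> (s *\<^sub>R u l + t *\<^sub>R u j) \<le> v l \<bullet> u l" by (simp add: inner_commute)
    qed (use fl fj o in auto)
  qed
  show ?thesis
    using *[of l j] *[of j l] l j \<open>l \<noteq> j\<close>
    by (cases l j rule: linorder_cases) (auto simp: orthogonal_def inner_commute)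
qed

text \<open>In the bases given by principal vectors, the double sum of \<open>trace_proj_mat_mult\<close> keeps only
its diagonal terms \<open>(u l \<bullet> v l)\<^sup>2 = cos\<^sup>2 \<theta>\<^sub>l\<close>. As this holds for every choice of principal
vectors, the choice operator in the definition is harmless.\<close>

lemma chordal_dist_squared:
  fixes U V :: "(real ^ 'm) set"
  assumes U: "subspace U" and V: "subspace V" and dim: "dim V = dim U"
  shows "(chordal_dist U V)\<^sup>2 = real (dim U) - trace (proj_mat U ** proj_mat V)"
proof -
  define \<theta> where "\<theta> = (SOME \<theta>. principal_angles U V \<theta>)"
  obtain u v where "principal_vectors U V u v"
    using principal_vectors_exist[OF assms] by blast
  then have "principal_angles U V (\<lambda>l. arccos (u l \<bullet> v l))"
    by (auto simp: principal_angles_def)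
  then have "principal_angles U V \<theta>" unfolding \<theta>_def by (rule someI[where P="principal_angles U V"])
  then obtain u v where pv: "principal_vectors U V u v"
    and \<theta>: "\<And>l. l < dim U \<Longrightarrow> \<theta> l = arccos (u l \<bullet> v l)"
    by (auto simp: principal_angles_def)
  note on = principal_vectors_orthonormal[OF pv dim]
  \<comment> \<open>Cosines in \<open>[-1, 1]\<close> are needed for \<open>cos\<close> to invert \<open>arccos\<close>.\<close>
  have "norm (u l) = 1" "norm (v l) = 1" if "l < dim U" for l
    using on(1,2) that dim by (auto simp: orthonormal_family_def norm_eq_1)
  then have bd: "\<bar>u l \<bullet> v l\<bar> \<le> 1" if "l < dim U" for l
    using Cauchy_Schwarz_ineq2[of "u l" "v l"] that by auto
  have "(\<Sum>l<dim U. (sin (\<theta> l))\<^sup>2) = (\<Sum>l<dim U. 1 - (u l \<bullet> v l)\<^sup>2)"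
  proof (rule sum.cong[OF refl])
    fix l assume "l \<in> {..<dim U}"
    then have l: "l < dim U" by simp
    have "cos (\<theta> l) = u l \<bullet> v l"
      using \<theta>[OF l] bd[OF l] by (simp add: cos_arccos abs_le_iff)
    then show "(sin (\<theta> l))\<^sup>2 = 1 - (u l \<bullet> v l)\<^sup>2" by (simp add: sin_squared_eq)
  qed
  also have "\<dots> = real (dim U) - (\<Sum>l<dim U. (u l \<bullet> v l)\<^sup>2)"
    by (simp add: sum_subtractf)
  also have "(\<Sum>l<dim U. (u l \<bullet> v l)\<^sup>2) = (\<Sum>l<dim U. \<Sum>j<dim V. (u l \<bullet> v j)\<^sup>2)"
  proof (rule sum.cong[OF refl])
    fix l assume "l \<in> {..<dim U}"
    then have "(\<Sum>j<dim V. (u l \<bullet> v j)\<^sup>2) = (\<Sum>j<dim V. if l = j then (u l \<bullet> v l)\<^sup>2 else 0)"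
      using principal_vectors_cross_orthogonal[OF U V dim pv] dim by (intro sum.cong) auto
    then show "(u l \<bullet> v l)\<^sup>2 = (\<Sum>j<dim V. (u l \<bullet> v j)\<^sup>2)"
      using \<open>l \<in> {..<dim U}\<close> dim by simp
  qed
  also have "\<dots> = trace (proj_mat U ** proj_mat V)"
    using trace_proj_mat_mult[OF U on(1,3) V on(2,4)] by simp
  finally have "(\<Sum>l<dim U. (sin (\<theta> l))\<^sup>2) = real (dim U) - trace (proj_mat U ** proj_mat V)" .
  moreover have "0 \<le> (\<Sum>l<dim U. (sin (\<theta> l))\<^sup>2)" by (intro sum_nonneg) auto
  ultimately show ?thesis
    by (simp add: chordal_dist_def Let_def flip: \<theta>_def)
qed

section \<open>Second moments of random vectors\<close>

text \<open>Square integrability by components, since \<open>cross_moment\<close> consists of the moments of products of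
components.\<close>

definition square_integrable :: "'w measure \<Rightarrow> ('w \<Rightarrow> real ^ 'a) \<Rightarrow> bool" where
  "square_integrable P X \<longleftrightarrow>
     (\<forall>a. (\<lambda>\<omega>. X \<omega> $ a) \<in> borel_measurable P \<and> integrable P (\<lambda>\<omega>. (X \<omega> $ a)\<^sup>2))"

lemma square_integrable_imp_integrable_mult:
  assumes "square_integrable P X" "square_integrable P Y"
  shows "integrable P (\<lambda>\<omega>. X \<omega> $ a * Y \<omega> $ b)"
proof (rule Bochner_Integration.integrable_bound)
  show "integrable P (\<lambda>\<omega>. (X \<omega> $ a)\<^sup>2 + (Y \<omega> $ b)\<^sup>2)"
    using assms by (auto simp: square_integrable_def)
  show "(\<lambda>\<omega>. X \<omega> $ a * Y \<omega> $ b) \<in> borel_measurable P"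
    using assms by (intro borel_measurable_times) (auto simp: square_integrable_def)
  have "\<bar>s * t\<bar> \<le> \<bar>s\<^sup>2 + t\<^sup>2\<bar>" for s t :: real
  proof -
    have "2 * \<bar>s * t\<bar> \<le> s\<^sup>2 + t\<^sup>2"
      using sum_squares_bound[of "\<bar>s\<bar>" "\<bar>t\<bar>"] by (simp add: abs_mult)
    then show ?thesis by linarith
  qed
  then show "AE \<omega> in P. norm (X \<omega> $ a * Y \<omega> $ b) \<le> norm ((X \<omega> $ a)\<^sup>2 + (Y \<omega> $ b)\<^sup>2)"
    by simp
qed

lemma square_integrable_iff:
  "square_integrable P X \<longleftrightarrow>
     (\<forall>a. (\<lambda>\<omega>. X \<omega> $ a) \<in> borel_measurable P) \<and>
     (\<forall>a b. integrable P (\<lambda>\<omega>. X \<omega> $ a * X \<omega> $ b))"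
proof
  assume "square_integrable P X"
  then show "(\<forall>a. (\<lambda>\<omega>. X \<omega> $ a) \<in> borel_measurable P) \<and>
      (\<forall>a b. integrable P (\<lambda>\<omega>. X \<omega> $ a * X \<omega> $ b))"
    using square_integrable_imp_integrable_mult[of P X X] by (simp add: square_integrable_def)
qed (simp add: square_integrable_def power2_eq_square)

lemma square_integrable_matrix_mult:
  assumes "square_integrable P X"
  shows "square_integrable P (\<lambda>\<omega>. A *v X \<omega>)"
  unfolding square_integrable_iff
proof (intro conjI allI)
  show "(\<lambda>\<omega>. (A *v X \<omega>) $ a) \<in> borel_measurable P" for a
    using assms unfolding matrix_vector_mult_def square_integrable_def
    by (simp add: borel_measurable_sum borel_measurable_times)
  have "(A *v X \<omega>) $ a * (A *v X \<omega>) $ b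
      = (\<Sum>c\<in>UNIV. \<Sum>e\<in>UNIV. (A $ a $ c * A $ b $ e) * (X \<omega> $ c * X \<omega> $ e))" for a b \<omega>
    by (simp add: matrix_vector_mult_def sum_product mult_ac)
  then show "integrable P (\<lambda>\<omega>. (A *v X \<omega>) $ a * (A *v X \<omega>) $ b)" for a b
    using assms by (simp add: square_integrable_imp_integrable_mult)
qed

lemma square_integrable_add:
  assumes X: "square_integrable P X" and Y: "square_integrable P Y"
  shows "square_integrable P (\<lambda>\<omega>. X \<omega> + Y \<omega>)"
  unfolding square_integrable_iff
proof (intro conjI allI)
  show "(\<lambda>\<omega>. (X \<omega> + Y \<omega>) $ a) \<in> borel_measurable P" for a
    unfolding vector_add_component
    by (rule borel_measurable_add) (use X Y in \<open>auto simp: square_integrable_def\<close>)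
  show "integrable P (\<lambda>\<omega>. (X \<omega> + Y \<omega>) $ a * (X \<omega> + Y \<omega>) $ b)" for a b
    unfolding vector_add_component distrib_left distrib_right
    by (intro Bochner_Integration.integrable_add square_integrable_imp_integrable_mult X Y)
qed

lemma square_integrableI_norm:
  fixes X :: "'w \<Rightarrow> real ^ 'a"
  assumes "X \<in> borel_measurable P" "integrable P (\<lambda>\<omega>. (norm (X \<omega>))\<^sup>2)"
  shows "square_integrable P X"
  unfolding square_integrable_def
proof (intro allI conjI)
  fix a
  have meas [measurable]: "(\<lambda>\<omega>. X \<omega> $ a) \<in> borel_measurable P"
    using borel_measurable_inner[OF assms(1) borel_measurable_const[of "axis a 1"]]
    by (simp add: inner_axis)
  then show "(\<lambda>\<omega>. X \<omega> $ a) \<in> borel_measurable P" .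
  show "integrable P (\<lambda>\<omega>. (X \<omega> $ a)\<^sup>2)"
    by (rule Bochner_Integration.integrable_bound[OF assms(2)])
      (auto simp: component_le_norm_cart abs_le_square_iff[symmetric] power_mono)
qed

lemma cross_moment_transpose:
  "cross_moment P Y X = transpose (cross_moment P X Y)"
  by (simp add: cross_moment_def transpose_def vec_eq_iff mult.commute)

lemma cross_moment_add_left:
  assumes "square_integrable P X" "square_integrable P Y" "square_integrable P Z"
  shows "cross_moment P (\<lambda>\<omega>. X \<omega> + Y \<omega>) Z = cross_moment P X Z + cross_moment P Y Z"
  using assms
  by (simp add: cross_moment_def vec_eq_iff distrib_right square_integrable_imp_integrable_mult)

lemma cross_moment_add_right:
  assumes "square_integrable P X" "square_integrable P Y" "square_integrable P Z"
  shows "cross_moment P Z (\<lambda>\<omega>. X \<omega> + Y \<omega>) = cross_moment P Z X + cross_moment P Z Y"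
  using assms
  by (simp add: cross_moment_def vec_eq_iff distrib_left square_integrable_imp_integrable_mult)

lemma cross_moment_mult_left:
  assumes "square_integrable P X" "square_integrable P Y"
  shows "cross_moment P (\<lambda>\<omega>. A *v X \<omega>) Y = A ** cross_moment P X Y"
  using assms
  by (simp add: cross_moment_def vec_eq_iff matrix_vector_mult_def matrix_matrix_mult_def
      sum_distrib_right mult.assoc square_integrable_imp_integrable_mult)

lemma cross_moment_mult_right:
  assumes "square_integrable P X" "square_integrable P Y"
  shows "cross_moment P X (\<lambda>\<omega>. A *v Y \<omega>) = cross_moment P X Y ** transpose A"
  using cross_moment_mult_left[OF assms(2,1), of A]
  by (metis cross_moment_transpose matrix_transpose_mul)

text \<open>Both the measurement and the estimation error are linear images of the signal and the stacked
noise, which are white and uncorrelated; this rule yields every covariance matrix that occurs.\<close>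

lemma cross_moment_linear:
  assumes X: "square_integrable P X" and Y: "square_integrable P Y"
    and XX: "cross_moment P X X = s *\<^sub>R mat 1" and YY: "cross_moment P Y Y = t *\<^sub>R mat 1"
    and XY: "cross_moment P X Y = 0"
  shows "cross_moment P (\<lambda>\<omega>. A *v X \<omega> + B *v Y \<omega>) (\<lambda>\<omega>. C *v X \<omega> + D *v Y \<omega>)
       = s *\<^sub>R (A ** transpose C) + t *\<^sub>R (B ** transpose D)"
proof -
  have YX: "cross_moment P Y X = 0"
    using XY by (subst cross_moment_transpose) (simp add: transpose_def vec_eq_iff)
  note si = X Y square_integrable_matrix_mult square_integrable_add
  show ?thesis
    by (simp add: cross_moment_add_left cross_moment_add_right cross_moment_mult_left
        cross_moment_mult_right si XX YY XY YX matrix_mul_assoc matrix_scalar_ac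
        flip: scalar_matrix_assoc)
qed

section \<open>The stacked measurement and its LMMSE filter\<close>

text \<open>The matrix \<open>T\<close> whose blocks are the projections, so that \<open>z = T x + \<nu>\<close>.\<close>

definition analysis_mat :: "('i::finite \<Rightarrow> (real ^ 'm) set) \<Rightarrow> real ^ 'm ^ ('i \<times> 'm)" where
  "analysis_mat W = (\<chi> p b. proj_mat (W (fst p)) $ snd p $ b)"

definition stacked :: "('i::finite \<Rightarrow> 'w \<Rightarrow> real ^ 'm) \<Rightarrow> 'w \<Rightarrow> real ^ ('i \<times> 'm)" where
  "stacked n \<omega> = (\<chi> p. n (fst p) \<omega> $ snd p)"

text \<open>The factor \<open>mat 1\<close> gives the right-hand side the shape of \<open>cross_moment_linear\<close>.\<close>

lemma measurement_eq:
  "measurement W x n \<omega> = analysis_mat W *v x \<omega> + mat 1 *v stacked n \<omega>"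
  unfolding matrix_vector_mul_lid
  by (simp add: measurement_def analysis_mat_def stacked_def vec_eq_iff matrix_vector_mult_def)

lemma erasure_mat_complement_entry:
  "(mat 1 - erasure_mat S) $ p $ q = (if p = q then if fst p \<in> S then 0 else 1 else 0)"
  by (simp add: mat_def erasure_mat_def)

text \<open>Blockwise, \<open>T\<^sup>T (I - E) T\<close> is the sum of the \<open>P\<^sub>i\<^sup>T P\<^sub>i\<close> over the surviving indices, and
\<open>P\<^sub>i\<^sup>T P\<^sub>i = P\<^sub>i\<close>. With nothing erased this is the frame operator.\<close>

lemma analysis_mat_restricted_gram:
  fixes W :: "'i::finite \<Rightarrow> (real ^ 'm) set"
  assumes W: "\<And>i. subspace (W i)"
  shows "transpose (analysis_mat W) ** (mat 1 - erasure_mat S) ** analysis_mat W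
       = (\<Sum>i\<in>- S. proj_mat (W i))"
proof -
  let ?T = "analysis_mat W"
  have "(transpose ?T ** (mat 1 - erasure_mat S) ** ?T) $ a $ b = (\<Sum>i\<in>- S. proj_mat (W i)) $ a $ b"
    for a b
  proof -
    have "(transpose ?T ** (mat 1 - erasure_mat S)) $ a $ p = (if fst p \<in> S then 0 else ?T $ p $ a)" for p
      unfolding matrix_matrix_mult_def
      by (simp add: erasure_mat_complement_entry transpose_def if_distrib[of "\<lambda>t. _ * t"] cong: if_cong
          del: vector_minus_component)
    then have "(transpose ?T ** (mat 1 - erasure_mat S) ** ?T) $ a $ b
        = (\<Sum>p\<in>UNIV. if fst p \<in> S then 0 else ?T $ p $ a * ?T $ p $ b)"
      by (subst matrix_matrix_mult_def) (auto intro!: sum.cong)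
    also have "\<dots> = (\<Sum>i\<in>UNIV. \<Sum>c\<in>UNIV. if i \<in> S then 0 else
        proj_mat (W i) $ c $ a * proj_mat (W i) $ c $ b)"
      by (simp add: analysis_mat_def sum.cartesian_product UNIV_Times_UNIV
          case_prod_beta cong: if_cong)
    also have "\<dots> = (\<Sum>i\<in>UNIV. if i \<in> S then 0 else proj_mat (W i) $ a $ b)"
    proof (rule sum.cong[OF refl])
      fix i
      have "(\<Sum>c\<in>UNIV. proj_mat (W i) $ a $ c * proj_mat (W i) $ c $ b) = proj_mat (W i) $ a $ b"
        using proj_mat_idem[OF W[of i]] by (simp add: matrix_matrix_mult_def vec_eq_iff)
      then show "(\<Sum>c\<in>UNIV. if i \<in> S then 0 else
          proj_mat (W i) $ c $ a * proj_mat (W i) $ c $ b)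
        = (if i \<in> S then 0 else proj_mat (W i) $ a $ b)"
        using transpose_proj_mat[OF W[of i]] by (simp add: transpose_def vec_eq_iff)
    qed
    also have "\<dots> = (\<Sum>i\<in>- S. proj_mat (W i) $ a $ b)"
      by (rule sum.mono_neutral_cong_right) auto
    finally show ?thesis by simp
  qed
  then show ?thesis by (simp add: vec_eq_iff)
qed

lemma erasure_mat_complement_idem:
  "(mat 1 - erasure_mat S) ** (mat 1 - erasure_mat S :: real ^ ('i::finite \<times> 'm::finite) ^ ('i \<times> 'm))
     = mat 1 - erasure_mat S"
  by (simp add: vec_eq_iff matrix_matrix_mult_def erasure_mat_complement_entry
      if_distrib[of "\<lambda>t. _ * t"] cong: if_cong del: vector_minus_component)

lemma transpose_diff: "transpose (A - B) = transpose A - transpose B"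
  by (simp add: transpose_def vec_eq_iff)

lemma transpose_erasure_mat: "transpose (erasure_mat S) = erasure_mat S"
  by (auto simp: transpose_def erasure_mat_def vec_eq_iff)

lemma measurement_model_stacked:
  fixes x :: "'w \<Rightarrow> real ^ 'm" and n :: "'i::finite \<Rightarrow> 'w \<Rightarrow> real ^ 'm"
  assumes "measurement_model P \<sigma>x \<sigma>n x n"
  shows "square_integrable P x" "square_integrable P (stacked n)"
    "cross_moment P x x = \<sigma>x\<^sup>2 *\<^sub>R mat 1"
    "cross_moment P (stacked n) (stacked n) = \<sigma>n\<^sup>2 *\<^sub>R mat 1"
    "cross_moment P x (stacked n) = 0"
proof -
  note mm = assms[unfolded measurement_model_def]
  show "square_integrable P x" using mm by (intro square_integrableI_norm) auto
  have "square_integrable P (n i)" for i using mm by (intro square_integrableI_norm) auto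
  then show "square_integrable P (stacked n)"
    by (simp add: square_integrable_def stacked_def)
  show "cross_moment P x x = \<sigma>x\<^sup>2 *\<^sub>R mat 1" using mm by simp
  have nn: "cross_moment P (n i) (n j) = (if i = j then \<sigma>n\<^sup>2 *\<^sub>R mat 1 else 0)" for i j
    using mm by simp
  have "cross_moment P (stacked n) (stacked n) $ p $ q
      = cross_moment P (n (fst p)) (n (fst q)) $ snd p $ snd q" for p q
    by (simp add: cross_moment_def stacked_def)
  then show "cross_moment P (stacked n) (stacked n) = \<sigma>n\<^sup>2 *\<^sub>R mat 1"
    by (auto simp: vec_eq_iff nn mat_def prod_eq_iff)
  have "cross_moment P x (stacked n) $ a $ q = cross_moment P x (n (fst q)) $ a $ snd q" for a q
    by (simp add: cross_moment_def stacked_def)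
  moreover have "cross_moment P x (n i) = 0" for i using mm by simp
  ultimately show "cross_moment P x (stacked n) = 0" by (simp add: vec_eq_iff)
qed

text \<open>If the matrix kills \<open>v\<close>, then \<open>0 = s |T\<^sup>T v|\<^sup>2 + t |v|\<^sup>2\<close>. This makes \<open>E[z z\<^sup>T]\<close>
invertible, so that \<open>matrix_inv\<close> is a true inverse.\<close>

lemma invertible_gram_plus_identity:
  fixes T :: "real ^ 'm ^ 'p"
  assumes "0 \<le> s" "0 < t"
  shows "invertible (s *\<^sub>R (T ** transpose T) + t *\<^sub>R mat 1)"
  unfolding invertible_left_inverse matrix_left_invertible_ker
proof (intro allI impI)
  fix v assume v: "(s *\<^sub>R (T ** transpose T) + t *\<^sub>R mat 1) *v v = 0"
  have "(s *\<^sub>R (T ** transpose T) + t *\<^sub>R mat 1) *v v = s *\<^sub>R (T *v (transpose T *v v)) + t *\<^sub>R v"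
    by (simp add: matrix_vector_mult_add_rdistrib matrix_vector_mul_assoc[symmetric]
        scaleR_matrix_vector_assoc[symmetric])
  then have "0 = v \<bullet> (s *\<^sub>R (T *v (transpose T *v v)) + t *\<^sub>R v)" using v by simp
  also have "\<dots> = s * (norm (transpose T *v v))\<^sup>2 + t * (norm v)\<^sup>2"
    by (simp add: inner_add_right power2_norm_eq_inner dot_lmul_matrix[symmetric])
  finally have "t * (norm v)\<^sup>2 = 0"
    using assms by (smt (verit) mult_nonneg_nonneg zero_le_power2)
  then show "v = 0" using assms by simp
qed

text \<open>With \<open>R = E[z z\<^sup>T]\<close>, tightness gives
\<open>T\<^sup>T R = (\<sigma>x\<^sup>2 A + \<sigma>n\<^sup>2) T\<^sup>T\<close>. So \<open>E[x z\<^sup>T] = \<sigma>x\<^sup>2 T\<^sup>T\<close> equals \<open>\<alpha> T\<^sup>T R\<close>, and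
multiplication with the inverse of \<open>R\<close> cancels \<open>R\<close> without computing the inverse.\<close>

lemma lmmse_filter_tight:
  fixes W :: "'i::finite \<Rightarrow> (real ^ 'm) set"
  assumes mm: "measurement_model P \<sigma>x \<sigma>n x n" and "\<sigma>n \<noteq> 0"
    and tight: "tight_fusion_frame W A"
  shows "lmmse_filter P x (measurement W x n)
       = (\<sigma>x\<^sup>2 / (\<sigma>x\<^sup>2 * A + \<sigma>n\<^sup>2)) *\<^sub>R transpose (analysis_mat W)"
proof -
  let ?T = "analysis_mat W" and ?c = "\<sigma>x\<^sup>2 * A + \<sigma>n\<^sup>2"
  let ?R = "\<sigma>x\<^sup>2 *\<^sub>R (?T ** transpose ?T) + \<sigma>n\<^sup>2 *\<^sub>R mat 1"
  note m = measurement_model_stacked[OF mm]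
  have W: "subspace (W i)" for i using tight by (simp add: tight_fusion_frame_def)
  have A: "0 < A" using tight by (simp add: tight_fusion_frame_def)
  have c: "?c > 0" using A \<open>\<sigma>n \<noteq> 0\<close> by (simp add: add_nonneg_pos)
  have z: "measurement W x n = (\<lambda>\<omega>. ?T *v x \<omega> + mat 1 *v stacked n \<omega>)"
    by (simp add: measurement_eq fun_eq_iff)
  have zz: "cross_moment P (measurement W x n) (measurement W x n) = ?R"
    unfolding z cross_moment_linear[OF m] by simp
  have "cross_moment P x (measurement W x n)
      = cross_moment P (\<lambda>\<omega>. mat 1 *v x \<omega> + 0 *v stacked n \<omega>) (measurement W x n)"
    by simp
  also have "\<dots> = \<sigma>x\<^sup>2 *\<^sub>R transpose ?T"
    unfolding z cross_moment_linear[OF m] by simp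
  finally have xz: "cross_moment P x (measurement W x n) = \<sigma>x\<^sup>2 *\<^sub>R transpose ?T" .
  have "transpose ?T ** ?T = A *\<^sub>R mat 1"
    using analysis_mat_restricted_gram[of W "{}", OF W] tight
    by (simp add: tight_fusion_frame_def erasure_mat_def zero_vec_def[symmetric])
  then have "transpose ?T ** ?R = ?c *\<^sub>R transpose ?T"
    by (simp add: matrix_add_ldistrib matrix_scalar_ac scalar_matrix_assoc[symmetric] matrix_mul_assoc
        scaleR_left_distrib)
  then have eq: "\<sigma>x\<^sup>2 *\<^sub>R transpose ?T = ((\<sigma>x\<^sup>2 / ?c) *\<^sub>R transpose ?T) ** ?R"
    using c by (simp add: scalar_matrix_assoc[symmetric])
  have "invertible ?R"
    using \<open>\<sigma>n \<noteq> 0\<close> by (intro invertible_gram_plus_identity) auto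
  then have "?R ** matrix_inv ?R = mat 1"
    unfolding invertible_def matrix_inv_def by (rule someI2_ex) simp
  then show ?thesis
    unfolding lmmse_filter_def zz xz eq by (simp flip: matrix_mul_assoc)
qed

section \<open>The mean-squared error under erasures\<close>

lemma matrix_add_rdistrib:
  fixes A B :: "'a::semiring_1 ^ 'm ^ 'n"
  shows "(A + B) ** C = A ** C + B ** C"
  by (simp add: matrix_matrix_mult_def vec_eq_iff distrib_right sum.distrib)

lemma trace_scaleR: "trace (c *\<^sub>R A) = c * trace (A :: real ^ 'a ^ 'a)"
  by (simp add: trace_def sum_distrib_left)

lemma trace_sum: "trace (\<Sum>i\<in>I. A i :: real ^ 'a ^ 'a) = (\<Sum>i\<in>I. trace (A i))"
  by (simp add: trace_def sum.swap[of _ I])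

text \<open>With \<open>L = \<alpha> T\<^sup>T (I - E)\<close> the error is \<open>(I - L T) x - L \<nu>\<close>, and
\<open>I - L T = (1 - \<alpha> A) I + \<alpha> C\<close> because surviving and erased projections add up to \<open>A I\<close>.
Expanding the square leaves cross terms in \<open>tr C\<close>, which combine with the noise
contribution through \<open>\<sigma>x\<^sup>2 (1 - \<alpha> A) = \<alpha> \<sigma>n\<^sup>2\<close>.\<close>

lemma erasure_mse_tight:
  fixes W :: "'i::finite \<Rightarrow> (real ^ 'm) set" and S :: "'i set"
  assumes mm: "measurement_model P \<sigma>x \<sigma>n x n" and "\<sigma>n \<noteq> 0"
    and tight: "tight_fusion_frame W A"
  defines "\<alpha> \<equiv> \<sigma>x\<^sup>2 / (\<sigma>x\<^sup>2 * A + \<sigma>n\<^sup>2)"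
    and "C \<equiv> (\<Sum>i\<in>S. proj_mat (W i))"
  shows "erasure_mse P x n W S = real CARD('m) * (\<sigma>x\<^sup>2 * (1 - \<alpha> * A)\<^sup>2 + \<sigma>n\<^sup>2 * \<alpha>\<^sup>2 * A)
      + \<alpha>\<^sup>2 * \<sigma>n\<^sup>2 * trace C + \<alpha>\<^sup>2 * \<sigma>x\<^sup>2 * trace (C ** C)"
proof -
  let ?T = "analysis_mat W" and ?E = "mat 1 - erasure_mat S :: real ^ ('i \<times> 'm) ^ ('i \<times> 'm)"
  define B where "B = (\<Sum>i\<in>- S. proj_mat (W i))"
  define L where "L = \<alpha> *\<^sub>R (transpose ?T ** ?E)"
  note m = measurement_model_stacked[OF mm]
  have W: "subspace (W i)" for i using tight by (simp add: tight_fusion_frame_def)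
  have A: "0 < A" using tight by (simp add: tight_fusion_frame_def)
  have c: "\<sigma>x\<^sup>2 * A + \<sigma>n\<^sup>2 > 0" using A \<open>\<sigma>n \<noteq> 0\<close> by (simp add: add_nonneg_pos)
  have "B + C = A *\<^sub>R mat 1"
    using tight sum.union_disjoint[of "- S" S "\<lambda>i. proj_mat (W i)"]
    by (simp add: B_def C_def tight_fusion_frame_def Un_commute Compl_partition)
  then have B: "B = A *\<^sub>R mat 1 - C" by (simp add: eq_diff_eq)
  have LT: "L ** ?T = \<alpha> *\<^sub>R B"
    unfolding L_def B_def scalar_matrix_assoc[symmetric] analysis_mat_restricted_gram[OF W] ..
  have "transpose L = \<alpha> *\<^sub>R (?E ** ?T)"
    by (simp add: L_def transpose_scalar matrix_transpose_mul transpose_diff transpose_erasure_mat)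
  then have LL: "L ** transpose L = \<alpha>\<^sup>2 *\<^sub>R B"
    unfolding L_def B_def analysis_mat_restricted_gram[OF W, where S = S, symmetric]
    by (simp add: matrix_scalar_ac scalar_matrix_assoc[symmetric] power2_eq_square
        matrix_mul_assoc erasure_mat_complement_idem flip: matrix_mul_assoc[of _ ?E ?E])
  have minus: "(- L) *v v = - (L *v v)" for v
    by (simp add: matrix_vector_mult_def vec_eq_iff sum_negf)
  have "x \<omega> - erasure_estimate P x n W S \<omega> = (mat 1 - L ** ?T) *v x \<omega> + (- L) *v stacked n \<omega>" for \<omega>
    unfolding erasure_estimate_def lmmse_filter_tight[OF assms(1-3)] \<alpha>_def[symmetric]
    unfolding minus
    by (simp add: L_def measurement_eq scalar_matrix_assoc[symmetric] algebra_simps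
        matrix_vector_mul_assoc matrix_vector_right_distrib)
  then have "erasure_mse P x n W S = trace (\<sigma>x\<^sup>2 *\<^sub>R ((mat 1 - L ** ?T) ** transpose (mat 1 - L ** ?T))
       + \<sigma>n\<^sup>2 *\<^sub>R ((- L) ** transpose (- L)))"
    unfolding erasure_mse_def Let_def by (simp only: cross_moment_linear[OF m])
  also have "mat 1 - L ** ?T = (1 - \<alpha> * A) *\<^sub>R mat 1 + \<alpha> *\<^sub>R C"
    unfolding LT B by (simp add: algebra_simps)
  also have "transpose ((1 - \<alpha> * A) *\<^sub>R mat 1 + \<alpha> *\<^sub>R C) = (1 - \<alpha> * A) *\<^sub>R mat 1 + \<alpha> *\<^sub>R C"
  proof -
    have "transpose C = (\<Sum>i\<in>S. transpose (proj_mat (W i)))"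
      by (simp add: C_def transpose_def vec_eq_iff)
    then have "transpose C = C" by (simp add: C_def transpose_proj_mat[OF W])
    moreover have "transpose (p *\<^sub>R mat 1 + q *\<^sub>R C) = p *\<^sub>R transpose (mat 1) + q *\<^sub>R transpose C" for p q
      by (simp add: transpose_def vec_eq_iff)
    ultimately show ?thesis by simp
  qed
  also have "(- L) ** transpose (- L) = \<alpha>\<^sup>2 *\<^sub>R (A *\<^sub>R mat 1 - C)"
    unfolding B[symmetric] LL[symmetric]
    by (simp add: matrix_matrix_mult_def transpose_def vec_eq_iff)
  also have "((1 - \<alpha> * A) *\<^sub>R mat 1 + \<alpha> *\<^sub>R C) ** ((1 - \<alpha> * A) *\<^sub>R mat 1 + \<alpha> *\<^sub>R C)
      = (1 - \<alpha> * A)\<^sup>2 *\<^sub>R mat 1 + (2 * \<alpha> * (1 - \<alpha> * A)) *\<^sub>R C + \<alpha>\<^sup>2 *\<^sub>R (C ** C)"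
  proof -
    have "(p *\<^sub>R mat 1 + q *\<^sub>R C) ** (p *\<^sub>R mat 1 + q *\<^sub>R C)
        = p\<^sup>2 *\<^sub>R mat 1 + (2 * q * p) *\<^sub>R C + q\<^sup>2 *\<^sub>R (C ** C)" for p q
      by (simp add: matrix_add_ldistrib matrix_add_rdistrib matrix_scalar_ac
          scalar_matrix_assoc[symmetric] power2_eq_square vec_eq_iff algebra_simps)
    then show ?thesis .
  qed
  finally have "erasure_mse P x n W S =
      \<sigma>x\<^sup>2 * ((1 - \<alpha> * A)\<^sup>2 * real CARD('m) + 2 * \<alpha> * (1 - \<alpha> * A) * trace C + \<alpha>\<^sup>2 * trace (C ** C))
      + \<sigma>n\<^sup>2 * (\<alpha>\<^sup>2 * (A * real CARD('m) - trace C))"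
    by (simp add: trace_add trace_sub trace_scaleR trace_I)
  moreover have "\<sigma>x\<^sup>2 * (1 - \<alpha> * A) = \<alpha> * \<sigma>n\<^sup>2"
    using c by (simp add: \<alpha>_def field_simps)
  then have "\<sigma>x\<^sup>2 * (2 * \<alpha> * (1 - \<alpha> * A) * trace C) = 2 * \<alpha>\<^sup>2 * \<sigma>n\<^sup>2 * trace C"
    by (simp add: power2_eq_square)
  ultimately show ?thesis
    by (simp add: algebra_simps)
qed

section \<open>Frame potential and the largest chordal distance\<close>

text \<open>Cauchy-Schwarz for the diagonal of \<open>Q\<close> against the all-ones vector; \<open>tr (Q\<^sup>2)\<close> is the sum of
the squares of all entries of a symmetric \<open>Q\<close> and hence dominates that of the diagonal ones.\<close>

lemma trace_squared_le:
  fixes Q :: "real ^ 'm ^ 'm"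
  assumes "transpose Q = Q"
  shows "(trace Q)\<^sup>2 \<le> real CARD('m) * trace (Q ** Q)"
proof -
  have sym: "Q $ b $ a = Q $ a $ b" for a b
    using assms by (metis transpose_def vec_lambda_beta)
  have "(trace Q)\<^sup>2 \<le> (\<Sum>a\<in>UNIV. (Q $ a $ a)\<^sup>2) * real CARD('m)"
    unfolding trace_def by (rule sum_squared_le_sum_of_squares)
  also have "(\<Sum>a\<in>UNIV. (Q $ a $ a)\<^sup>2) \<le> (\<Sum>a\<in>UNIV. \<Sum>b\<in>UNIV. (Q $ a $ b)\<^sup>2)"
  proof (rule sum_mono)
    fix a
    show "(Q $ a $ a)\<^sup>2 \<le> (\<Sum>b\<in>UNIV. (Q $ a $ b)\<^sup>2)"
      by (rule member_le_sum) auto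
  qed
  also have "\<dots> = trace (Q ** Q)"
    by (simp add: trace_def matrix_matrix_mult_def sym power2_eq_square)
  finally show ?thesis by (simp add: mult_ac mult_right_mono)
qed

text \<open>The sum of all \<open>tr (P\<^sub>i P\<^sub>j)\<close> with \<open>i, j\<close> in \<open>S\<close>: diagonal terms contribute \<open>m\<close>, the others
\<open>m - d\<^sup>2\<close>. For the set of erased indices this enters the MSE; for all indices it enters
the bound on the chordal distance.\<close>

lemma frame_potential:
  fixes V :: "'i::finite \<Rightarrow> (real ^ 'm) set" and S :: "'i set"
  assumes "equi_distance_fusion_frame m d V"
  defines "C \<equiv> (\<Sum>i\<in>S. proj_mat (V i))"
  shows "trace C = real (card S) * real m"
    and "trace (C ** C) = real (card S) * real m + real (card S) * (real (card S) - 1) * (real m - d\<^sup>2)"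
proof -
  have V: "subspace (V i)" "dim (V i) = m" for i
    using assms(1) by (auto simp: equi_distance_fusion_frame_def fusion_frame_def)
  have d: "chordal_dist (V i) (V j) = d" if "i \<noteq> j" for i j
    using assms(1) that by (simp add: equi_distance_fusion_frame_def)
  show "trace C = real (card S) * real m"
    by (simp add: C_def trace_sum trace_proj_mat V)
  have pair: "trace (proj_mat (V i) ** proj_mat (V j)) = (if i = j then real m else real m - d\<^sup>2)" for i j
    using chordal_dist_squared[of "V i" "V j"] d[of i j] V
    by (auto simp: proj_mat_idem trace_proj_mat)
  have "C ** C = (\<Sum>i\<in>S. \<Sum>j\<in>S. proj_mat (V i) ** proj_mat (V j))"
  proof -
    have "(C ** C) $ a $ b = (\<Sum>i\<in>S. \<Sum>j\<in>S. proj_mat (V i) ** proj_mat (V j)) $ a $ b" for a b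
      unfolding C_def matrix_matrix_mult_def
      by (simp add: sum_product) (rule sum_swap3)
    then show ?thesis by (simp add: vec_eq_iff)
  qed
  then have "trace (C ** C) = (\<Sum>i\<in>S. \<Sum>j\<in>S. if i = j then real m else real m - d\<^sup>2)"
    by (simp add: trace_sum pair)
  also have "\<dots> = (\<Sum>i\<in>S. \<Sum>j\<in>S. (if i = j then d\<^sup>2 else 0) + (real m - d\<^sup>2))"
    by (intro sum.cong) auto
  also have "\<dots> = real (card S) * (d\<^sup>2 + real (card S) * (real m - d\<^sup>2))"
    by (simp add: sum.distrib)
  finally show "trace (C ** C) = real (card S) * real m + real (card S) * (real (card S) - 1) * (real m - d\<^sup>2)"
    by (simp add: algebra_simps)
qed

lemma fusion_frame_potential_bound:
  fixes V :: "'i::finite \<Rightarrow> (real ^ 'm) set"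
  assumes "\<And>i. subspace (V i)"
  defines "Q \<equiv> (\<Sum>i\<in>UNIV. proj_mat (V i))"
  shows "(trace Q)\<^sup>2 \<le> real CARD('m) * trace (Q ** Q)"
proof (rule trace_squared_le)
  have "transpose Q = (\<Sum>i\<in>UNIV. transpose (proj_mat (V i)))"
    by (simp add: Q_def transpose_def vec_eq_iff)
  then show "transpose Q = Q" by (simp add: Q_def transpose_proj_mat assms)
qed

text \<open>Comparing traces in the tightness condition determines \<open>A\<close>; so all tight frames of \<open>N\<close>
subspaces of dimension \<open>m\<close> have the same filter gain and the same no-erasure MSE.\<close>

lemma tight_frame_bound_eq:
  fixes V :: "'i::finite \<Rightarrow> (real ^ 'm) set"
  assumes "tight_fusion_frame V A" and "\<And>i. dim (V i) = m"
  shows "real CARD('m) * A = real CARD('i) * real m"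
proof -
  have "real CARD('m) * A = trace (\<Sum>i\<in>UNIV. proj_mat (V i))"
    using assms(1) by (simp add: tight_fusion_frame_def trace_scaleR trace_I mult.commute)
  also have "\<dots> = (\<Sum>i\<in>UNIV. trace (proj_mat (V i)))" by (rule trace_sum)
  also have "\<dots> = real CARD('i) * real m"
    using assms by (simp add: trace_proj_mat tight_fusion_frame_def)
  finally show ?thesis .
qed

text \<open>Tight equi-distance subspaces are maximal: the bound \<open>(N m)\<^sup>2 \<le> M tr (Q\<^sup>2)\<close> holds for
both families and is an equality for the tight one, while \<open>tr (Q\<^sup>2)\<close> decreases in the squared
distance once there are two subspaces.\<close>

lemma chordal_dist_le_tight:
  fixes V W :: "'i::finite \<Rightarrow> (real ^ 'm) set"
  assumes V: "equi_distance_fusion_frame m d' V"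
    and W: "equi_distance_tight_fusion_frame m d A W"
    and N: "1 < CARD('i)"
  shows "d'\<^sup>2 \<le> d\<^sup>2"
proof -
  let ?N = "real CARD('i)" and ?M = "real CARD('m)"
  let ?Q = "\<lambda>U :: 'i \<Rightarrow> (real ^ 'm) set. \<Sum>i\<in>UNIV. proj_mat (U i)"
  let ?pot = "\<lambda>d. ?N * real m + ?N * (?N - 1) * (real m - d\<^sup>2)"
  have subspaces: "subspace (V i)" for i
    using V by (simp add: equi_distance_fusion_frame_def fusion_frame_def)
  have tight: "tight_fusion_frame W A" and W': "equi_distance_fusion_frame m d W"
    using W by (auto simp: equi_distance_tight_fusion_frame_def)
  then have dim: "dim (W i) = m" for i by (simp add: equi_distance_fusion_frame_def)
  have pot: "trace (?Q V ** ?Q V) = ?pot d'" "trace (?Q W ** ?Q W) = ?pot d"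
    using frame_potential(2)[OF V, of UNIV] frame_potential(2)[OF W', of UNIV] by simp_all
  have "(?N * real m)\<^sup>2 \<le> ?M * ?pot d'"
    using fusion_frame_potential_bound[of V, OF subspaces] frame_potential(1)[OF V, of UNIV] pot by simp
  moreover have "?M * ?pot d = (?N * real m)\<^sup>2"
  proof -
    have "?Q W ** ?Q W = A\<^sup>2 *\<^sub>R mat 1"
      using tight by (simp add: tight_fusion_frame_def matrix_scalar_ac power2_eq_square
          flip: scalar_matrix_assoc)
    then have "?M * trace (?Q W ** ?Q W) = (?M * A)\<^sup>2"
      by (simp add: trace_scaleR trace_I power2_eq_square)
    then show ?thesis using pot tight_frame_bound_eq[OF tight dim] by simp
  qed
  ultimately have "?M * ?pot d \<le> ?M * ?pot d'" by simp
  then have "?pot d \<le> ?pot d'" by simp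
  then have "?N * (?N - 1) * (real m - d\<^sup>2) \<le> ?N * (?N - 1) * (real m - d'\<^sup>2)" by simp
  moreover have "0 < ?N * (?N - 1)" using N by simp
  ultimately show ?thesis by (simp add: mult_le_cancel_left_pos)
qed

section \<open>Optimality of maximal equi-distance subspaces\<close>

lemma erasure_mse_equi_distance_tight:
  fixes V :: "'i::finite \<Rightarrow> (real ^ 'm) set" and S :: "'i set"
  assumes mm: "measurement_model P \<sigma>x \<sigma>n x n" and "\<sigma>n \<noteq> 0"
    and V: "equi_distance_tight_fusion_frame m d A V"
  defines "\<alpha> \<equiv> \<sigma>x\<^sup>2 / (\<sigma>x\<^sup>2 * A + \<sigma>n\<^sup>2)"
  shows "erasure_mse P x n V S = real CARD('m) * (\<sigma>x\<^sup>2 * (1 - \<alpha> * A)\<^sup>2 + \<sigma>n\<^sup>2 * \<alpha>\<^sup>2 * A)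
    + extra_mse \<sigma>x \<sigma>n A m (card S) d"
proof -
  have tight: "tight_fusion_frame V A" and V': "equi_distance_fusion_frame m d V"
    using V by (auto simp: equi_distance_tight_fusion_frame_def)
  show ?thesis
    unfolding erasure_mse_tight[OF mm \<open>\<sigma>n \<noteq> 0\<close> tight] frame_potential[OF V'] extra_mse_def Let_def
      \<alpha>_def[symmetric]
    by (simp add: algebra_simps)
qed

lemma extra_mse_antimono:
  assumes "d'\<^sup>2 \<le> d\<^sup>2" "1 \<le> k"
  shows "extra_mse \<sigma>x \<sigma>n A m k d \<le> extra_mse \<sigma>x \<sigma>n A m k d'"
  unfolding extra_mse_def Let_def
  using assms by (intro add_left_mono mult_left_mono mult_nonneg_nonneg) auto

theorem theorem3p3:
  fixes P :: "'w measure"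
    and x :: "'w \<Rightarrow> real ^ 'm"
    and n :: "'i::finite \<Rightarrow> 'w \<Rightarrow> real ^ 'm"
    and W :: "'i \<Rightarrow> (real ^ 'm) set"
    and S :: "'i set"
    and \<sigma>x \<sigma>n A d :: real
    and m k :: nat
  assumes "measurement_model P \<sigma>x \<sigma>n x n"
    and "\<sigma>n \<noteq> 0"
    and "\<lceil>real CARD('m) / real CARD('i)\<rceil> \<le> int m"
    and "equi_distance_tight_fusion_frame m d A W"
    and "3 \<le> k" and "k < CARD('i)" and "card S = k"
  shows "(\<forall>V A' d'. equi_distance_tight_fusion_frame m d' A' V \<longrightarrow>
            erasure_mse P x n V S = erasure_mse P x n W {} + extra_mse \<sigma>x \<sigma>n A m k d')
       \<and> (\<forall>V A' d'. equi_distance_tight_fusion_frame m d' A' V \<longrightarrow>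
            erasure_mse P x n W S \<le> erasure_mse P x n V S)
       \<and> (\<forall>(V :: 'i \<Rightarrow> (real ^ 'm) set) d'. equi_distance_fusion_frame m d' V \<longrightarrow>
            erasure_mse P x n W S \<le> erasure_mse P x n W {} + extra_mse \<sigma>x \<sigma>n A m k d')"
proof -
  have tightD: "tight_fusion_frame V A'" "dim (V i) = m" "equi_distance_fusion_frame m d' V"
    if "equi_distance_tight_fusion_frame m d' A' V" for V :: "'i \<Rightarrow> (real ^ 'm) set" and A' d' i
    using that by (auto simp: equi_distance_tight_fusion_frame_def equi_distance_fusion_frame_def)
  have decomp: "erasure_mse P x n V S = erasure_mse P x n W {} + extra_mse \<sigma>x \<sigma>n A m k d'"
    if V: "equi_distance_tight_fusion_frame m d' A' V" for V A' d'
  proof -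
    have "real CARD('m) * A' = real CARD('m) * A"
      using tight_frame_bound_eq tightD(1,2)[OF V] tightD(1,2)[OF assms(4)] by metis
    then have "A' = A" by simp
    have "extra_mse \<sigma>x \<sigma>n A m (card ({} :: 'i set)) d = 0" by (simp add: extra_mse_def)
    then show ?thesis
      using erasure_mse_equi_distance_tight[OF assms(1,2) V[unfolded \<open>A' = A\<close>], of S]
        erasure_mse_equi_distance_tight[OF assms(1,2,4), of "{}"] assms(7)
      by simp
  qed
  have optimal: "erasure_mse P x n W S \<le> erasure_mse P x n W {} + extra_mse \<sigma>x \<sigma>n A m k d'"
    if V: "equi_distance_fusion_frame m d' V" for V :: "'i \<Rightarrow> (real ^ 'm) set" and d'
  proof -
    have "d'\<^sup>2 \<le> d\<^sup>2" using chordal_dist_le_tight[OF V assms(4)] assms(5,6) by simp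
    then have "extra_mse \<sigma>x \<sigma>n A m k d \<le> extra_mse \<sigma>x \<sigma>n A m k d'"
      using assms(5) by (intro extra_mse_antimono) auto
    then show ?thesis unfolding decomp[OF assms(4)] by simp
  qed
  show ?thesis
    using decomp optimal tightD(3) by metis
qed

end
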